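(* Let $R$ be a commutative ring with $1\neq 0$, let $S$ be a multiplicatively closed subset of $R$, and let $I$ be an ideal of $R$. Then $V_S(I)$ is a quasi-compact subset of $\mathrm{Spec}_SR$ with respect to the $S$-flat topology; that is, every closed subset with respect to the $S$-Zariski topology is a quasi-compact subset with respect to the $S$-flat topology.
   Context: A multiplicatively closed subset $S$ of $R$ satisfies $0\notin S$, $1\in S$, and $ss'\in S$ for all $s,s'\in S$. An ideal $P$ of $R$ is $S$-prime if $P\cap S=\emptyset$ and there exists $s\in S$ such that for all $a,b\in R$, $ab\in P$ implies $sa\in P$ or $sb\in P$. $\mathrm{Spec}_SR$ is the set of all $S$-prime ideals of $R$. For $E\subseteq R$, $V_S(E)=\{P\in\mathrm{Spec}_SR : sE\subseteq P \text{ for some } s\in S\}$; write $V_S(f)=V_S(\{f\})$. The $S$-Zariski topology on $\mathrm{Spec}_SR$ is the topology whose closed sets are the sets $V_S(I)$, $I$ an ideal of $R$. The $S$-flat topology on $\mathrm{Spec}_SR$ is the topology having the sets $V_S(f)$, $f\in R$, as a sub-basis of open sets; the sets $V_S(J)$ with $J$ a finitely generated ideal form a basis of it. Quasi-compact means every open cover has a finite subcover. *)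

theory Defs
  imports "HOL-Algebra.Algebra" "HOL-Analysis.Abstract_Topology"
begin

definition mult_closed_subset :: "('a, 'b) ring_scheme \<Rightarrow> 'a set \<Rightarrow> bool" where
  "mult_closed_subset R S \<longleftrightarrow>
     S \<subseteq> carrier R \<and> \<zero>\<^bsub>R\<^esub> \<notin> S \<and> \<one>\<^bsub>R\<^esub> \<in> S \<and>
     (\<forall>s\<in>S. \<forall>s'\<in>S. s \<otimes>\<^bsub>R\<^esub> s' \<in> S)"

definition S_prime :: "('a, 'b) ring_scheme \<Rightarrow> 'a set \<Rightarrow> 'a set \<Rightarrow> bool" where
  "S_prime R S P \<longleftrightarrow>
     ideal P R \<and> P \<inter> S = {} \<and>
     (\<exists>s\<in>S. \<forall>a\<in>carrier R. \<forall>b\<in>carrier R.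
        a \<otimes>\<^bsub>R\<^esub> b \<in> P \<longrightarrow> s \<otimes>\<^bsub>R\<^esub> a \<in> P \<or> s \<otimes>\<^bsub>R\<^esub> b \<in> P)"

definition S_Spec :: "('a, 'b) ring_scheme \<Rightarrow> 'a set \<Rightarrow> 'a set set" where
  "S_Spec R S = {P. S_prime R S P}"

text \<open>The library's left coset \<open>s <#\<^bsub>R\<^esub> E\<close> is the set of all products of \<open>s\<close> with elements of \<open>E\<close>.\<close>

definition S_V :: "('a, 'b) ring_scheme \<Rightarrow> 'a set \<Rightarrow> 'a set \<Rightarrow> 'a set set" where
  "S_V R S E = {P \<in> S_Spec R S. \<exists>s\<in>S. s <#\<^bsub>R\<^esub> E \<subseteq> P}"

text \<open>The constant \<open>topology\<close> is meaningful only on predicates satisfying \<open>istopology\<close>;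
  \<open>closedin_S_zariski_iff\<close> below shows that the closed sets are as intended.\<close>

definition S_zariski :: "('a, 'b) ring_scheme \<Rightarrow> 'a set \<Rightarrow> 'a set topology" where
  "S_zariski R S =
     topology (\<lambda>U. U \<subseteq> S_Spec R S \<and> (\<exists>I. ideal I R \<and> S_Spec R S - U = S_V R S I))"

text \<open>The underlying set of a generated topology is the union of the generating sets;
  by \<open>topspace_S_flat\<close> below it is the whole spectrum.\<close>

definition S_flat :: "('a, 'b) ring_scheme \<Rightarrow> 'a set \<Rightarrow> 'a set topology" where
  "S_flat R S = topology_generated_by {S_V R S {f} |f. f \<in> carrier R}"


lemma S_V_iff:
  "P \<in> S_V R S E \<longleftrightarrow> P \<in> S_Spec R S \<and> (\<exists>s\<in>S. \<forall>e\<in>E. s \<otimes>\<^bsub>R\<^esub> e \<in> P)"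
  unfolding S_V_def l_coset_def by blast

lemma S_V_zero:
  fixes R :: "('a, 'b) ring_scheme" (structure)
  assumes "cring R" "mult_closed_subset R S"
  shows "S_V R S {\<zero>\<^bsub>R\<^esub>} = S_Spec R S"
proof -
  interpret cring R by fact
  have "P \<in> S_V R S {\<zero>\<^bsub>R\<^esub>}" if P: "P \<in> S_Spec R S" for P
  proof -
    have "ideal P R" using P by (simp add: S_Spec_def S_prime_def)
    then have "\<zero>\<^bsub>R\<^esub> \<in> P" by (simp add: additive_subgroup.zero_closed ideal.axioms(1))
    then have "\<one> \<otimes> \<zero> \<in> P" by simp
    moreover have "\<one> \<in> S" using assms(2) by (simp add: mult_closed_subset_def)
    ultimately show ?thesis using P unfolding S_V_iff by blast
  qed
  then show ?thesis by (auto simp: S_V_iff)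
qed

lemma topspace_S_flat:
  assumes "cring R" "mult_closed_subset R S"
  shows "topspace (S_flat R S) = S_Spec R S"
proof -
  interpret cring R by fact
  have "S_V R S {f} \<subseteq> S_Spec R S" for f by (auto simp: S_V_iff)
  moreover have "S_Spec R S \<in> {S_V R S {f} |f. f \<in> carrier R}"
    using S_V_zero[OF assms] by blast
  ultimately show ?thesis
    unfolding S_flat_def topology_generated_by_topspace by blast
qed

lemma S_V_witness:
  assumes "cring R" "mult_closed_subset R S" "P \<in> S_Spec R S"
  obtains t where "t \<in> S"
    "\<And>a b. \<lbrakk>a \<in> carrier R; b \<in> carrier R; a \<otimes>\<^bsub>R\<^esub> b \<in> P\<rbrakk> \<Longrightarrow> t \<otimes>\<^bsub>R\<^esub> a \<in> P \<or> t \<otimes>\<^bsub>R\<^esub> b \<in> P"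
    "\<And>s a. \<lbrakk>s \<in> S; a \<in> carrier R; s \<otimes>\<^bsub>R\<^esub> a \<in> P\<rbrakk> \<Longrightarrow> t \<otimes>\<^bsub>R\<^esub> a \<in> P"
proof -
  obtain t where t: "t \<in> S"
    "\<And>a b. \<lbrakk>a \<in> carrier R; b \<in> carrier R; a \<otimes>\<^bsub>R\<^esub> b \<in> P\<rbrakk> \<Longrightarrow> t \<otimes>\<^bsub>R\<^esub> a \<in> P \<or> t \<otimes>\<^bsub>R\<^esub> b \<in> P"
    and d: "P \<inter> S = {}"
    using assms(3) by (auto simp: S_Spec_def S_prime_def)
  have "t \<otimes>\<^bsub>R\<^esub> a \<in> P" if "s \<in> S" "a \<in> carrier R" "s \<otimes>\<^bsub>R\<^esub> a \<in> P" for s a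
    using t(2)[of s a] that d t(1) assms(2) by (auto simp: mult_closed_subset_def)
  with t that show thesis by blast
qed

lemma S_V_genideal:
  fixes R :: "('a, 'b) ring_scheme" (structure)
  assumes "cring R" "mult_closed_subset R S" "E \<subseteq> carrier R"
  shows "S_V R S (genideal R E) = S_V R S E"
proof -
  interpret cring R by fact
  have "s \<otimes>\<^bsub>R\<^esub> x \<in> P"
    if s: "s \<in> S" and P: "P \<in> S_Spec R S" and E: "\<forall>e\<in>E. s \<otimes>\<^bsub>R\<^esub> e \<in> P"
      and x: "x \<in> genideal R E" for s P x
  proof -
    interpret P: ideal P R using P by (simp add: S_Spec_def S_prime_def)
    have sR: "s \<in> carrier R" using s assms(2) by (auto simp: mult_closed_subset_def)
    have "ideal {x \<in> carrier R. s \<otimes>\<^bsub>R\<^esub> x \<in> P} R"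
    proof (rule idealI)
      show "subgroup {x \<in> carrier R. s \<otimes> x \<in> P} (add_monoid R)"
      proof (rule add.subgroupI)
        show "{x \<in> carrier R. s \<otimes> x \<in> P} \<noteq> {}"
          using sR by (auto intro!: exI[of _ "\<zero>"])
        fix a assume "a \<in> {x \<in> carrier R. s \<otimes> x \<in> P}"
        then show "\<ominus> a \<in> {x \<in> carrier R. s \<otimes> x \<in> P}"
          using sR by (simp add: r_minus)
      qed (use sR in \<open>auto simp: r_distr\<close>)
    next
      fix a y assume a: "a \<in> {x \<in> carrier R. s \<otimes> x \<in> P}" and y: "y \<in> carrier R"
      then have "(s \<otimes> a) \<otimes> y \<in> P" by (simp add: P.I_r_closed)
      then show "a \<otimes> y \<in> {x \<in> carrier R. s \<otimes> x \<in> P}" "y \<otimes> a \<in> {x \<in> carrier R. s \<otimes> x \<in> P}"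
        using a y sR by (simp_all add: m_assoc m_comm[of y a])
    qed (rule ring_axioms)
    then have "genideal R E \<subseteq> {x \<in> carrier R. s \<otimes> x \<in> P}"
      by (rule genideal_minimal) (use E assms(3) in auto)
    with x show ?thesis by auto
  qed
  moreover have "E \<subseteq> genideal R E" using assms(3) by (rule genideal_self)
  ultimately show ?thesis unfolding S_V_iff set_eq_iff by blast
qed

lemma S_V_Int:
  fixes R :: "('a, 'b) ring_scheme" (structure)
  assumes "cring R" "mult_closed_subset R S" "ideal I R" "ideal J R"
  shows "S_V R S (I \<inter> J) = S_V R S I \<union> S_V R S J"
proof -
  interpret cring R by fact
  interpret I: ideal I R by fact
  interpret J: ideal J R by fact
  have "P \<in> S_V R S I \<union> S_V R S J" if P: "P \<in> S_V R S (I \<inter> J)" for P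
  proof (rule ccontr)
    assume n: "P \<notin> S_V R S I \<union> S_V R S J"
    have PS: "P \<in> S_Spec R S" using P by (simp add: S_V_iff)
    obtain s where s: "s \<in> S" "\<And>e. e \<in> I \<inter> J \<Longrightarrow> s \<otimes> e \<in> P" using P by (auto simp: S_V_iff)
    obtain t where t: "t \<in> S"
      "\<And>a b. \<lbrakk>a \<in> carrier R; b \<in> carrier R; a \<otimes> b \<in> P\<rbrakk> \<Longrightarrow> t \<otimes> a \<in> P \<or> t \<otimes> b \<in> P"
      "\<And>s a. \<lbrakk>s \<in> S; a \<in> carrier R; s \<otimes> a \<in> P\<rbrakk> \<Longrightarrow> t \<otimes> a \<in> P"
      by (rule S_V_witness[OF assms(1,2) PS]) blast
    have sub: "S \<subseteq> carrier R" "\<And>x y. x \<in> S \<Longrightarrow> y \<in> S \<Longrightarrow> x \<otimes> y \<in> S"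
      using assms(2) by (auto simp: mult_closed_subset_def)
    obtain a where a: "a \<in> I" "t \<otimes> a \<notin> P" using n PS t(1) by (auto simp: S_V_iff)
    obtain b where b: "b \<in> J" "t \<otimes> b \<notin> P" using n PS t(1) by (auto simp: S_V_iff)
    have c: "a \<in> carrier R" "b \<in> carrier R" "s \<in> carrier R" "t \<in> carrier R"
      using a b s(1) t(1) sub by auto
    have "a \<otimes> b \<in> I \<inter> J" using a b c I.I_r_closed J.I_l_closed by auto
    then have "t \<otimes> (a \<otimes> b) \<in> P" using s c t(3) by auto
    then have "(t \<otimes> a) \<otimes> b \<in> P" using c by (simp add: m_assoc)
    then have "t \<otimes> (t \<otimes> a) \<in> P" using t(2)[of "t \<otimes> a" b] c b by auto
    then have "(t \<otimes> t) \<otimes> a \<in> P" using c by (simp add: m_assoc)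
    then show False using t(3)[of "t \<otimes> t" a] sub t(1) c a by auto
  qed
  then have "S_V R S (I \<inter> J) \<subseteq> S_V R S I \<union> S_V R S J" by blast
  moreover have "S_V R S I \<union> S_V R S J \<subseteq> S_V R S (I \<inter> J)" unfolding subset_iff Un_iff S_V_iff by blast
  ultimately show ?thesis by (rule subset_antisym)
qed

lemma istopology_S_zariski:
  fixes R :: "('a, 'b) ring_scheme" (structure)
  assumes "cring R" "mult_closed_subset R S"
  shows "istopology (\<lambda>U. U \<subseteq> S_Spec R S \<and> (\<exists>I. ideal I R \<and> S_Spec R S - U = S_V R S I))"
    (is "istopology ?Q")
  unfolding istopology_def
proof (intro conjI allI impI)
  interpret cring R by fact
  fix U W assume "?Q U" "?Q W"
  then show "U \<inter> W \<subseteq> S_Spec R S" by blast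
  from \<open>?Q U\<close> \<open>?Q W\<close> obtain I J where "ideal I R" "ideal J R"
    "S_Spec R S - U = S_V R S I" "S_Spec R S - W = S_V R S J" by blast
  then have "ideal (I \<inter> J) R" "S_Spec R S - (U \<inter> W) = S_V R S (I \<inter> J)"
    using i_intersect S_V_Int[OF assms] by (simp_all add: Diff_Int)
  then show "\<exists>I. ideal I R \<and> S_Spec R S - (U \<inter> W) = S_V R S I" by blast
next
  interpret cring R by fact
  fix K assume K: "\<forall>U\<in>K. ?Q U"
  show "\<Union>K \<subseteq> S_Spec R S" by (rule Sup_least) (use K in simp)
  define E where "E = \<Union>{I. ideal I R \<and> S_Spec R S - S_V R S I \<in> K}"
  have E: "E \<subseteq> carrier R"
    unfolding E_def using additive_subgroup.a_subset ideal.axioms(1) by blast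
  have "S_Spec R S - \<Union>K = S_V R S E"
  proof (intro subset_antisym subsetI)
    fix P assume P: "P \<in> S_Spec R S - \<Union>K"
    then have PS: "P \<in> S_Spec R S" by blast
    obtain t where t: "t \<in> S"
      "\<And>s a. \<lbrakk>s \<in> S; a \<in> carrier R; s \<otimes> a \<in> P\<rbrakk> \<Longrightarrow> t \<otimes> a \<in> P"
      by (rule S_V_witness[OF assms PS]) blast
    have "t \<otimes> e \<in> P" if "e \<in> E" for e
    proof -
      obtain I where I: "S_Spec R S - S_V R S I \<in> K" "e \<in> I"
        using \<open>e \<in> E\<close> unfolding E_def by blast
      then have "P \<in> S_V R S I" using P by blast
      then obtain s where "s \<in> S" "s \<otimes> e \<in> P" using I(2) by (auto simp: S_V_iff)
      then show ?thesis using t(2) E \<open>e \<in> E\<close> by blast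
    qed
    then show "P \<in> S_V R S E" using PS t(1) by (auto simp: S_V_iff)
  next
    fix P assume P: "P \<in> S_V R S E"
    have "P \<notin> U" if "U \<in> K" for U
    proof -
      have "?Q U" using K \<open>U \<in> K\<close> by (rule bspec)
      then obtain I where I: "ideal I R" "S_Spec R S - U = S_V R S I" "U \<subseteq> S_Spec R S"
        by (elim conjE exE)
      have "S_Spec R S - S_V R S I = U" using I(3) unfolding I(2)[symmetric] by (rule double_diff) simp
      with \<open>U \<in> K\<close> have "S_Spec R S - S_V R S I \<in> K" by simp
      then have "I \<subseteq> E" using I(1) unfolding E_def by blast
      have "P \<in> S_Spec R S" using P by (simp add: S_V_iff)
      moreover obtain s where "s \<in> S" "\<And>e. e \<in> E \<Longrightarrow> s \<otimes> e \<in> P"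
        using P by (auto simp: S_V_iff)
      ultimately have "P \<in> S_V R S I" using \<open>I \<subseteq> E\<close> unfolding S_V_iff by blast
      then show ?thesis unfolding I(2)[symmetric] by simp
    qed
    then show "P \<in> S_Spec R S - \<Union>K" using P by (auto simp: S_V_iff)
  qed
  then have "S_Spec R S - \<Union>K = S_V R S (genideal R E)"
    using S_V_genideal[OF assms E] by simp
  then show "\<exists>I. ideal I R \<and> S_Spec R S - \<Union>K = S_V R S I"
    using genideal_ideal[OF E] by blast
qed

lemma closedin_S_zariski_iff:
  fixes R :: "('a, 'b) ring_scheme" (structure)
  assumes "cring R" "mult_closed_subset R S"
  shows "closedin (S_zariski R S) C \<longleftrightarrow> (\<exists>I. ideal I R \<and> C = S_V R S I)"
proof -
  interpret cring R by fact
  have o: "openin (S_zariski R S) U \<longleftrightarrow>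
      U \<subseteq> S_Spec R S \<and> (\<exists>I. ideal I R \<and> S_Spec R S - U = S_V R S I)" for U
    unfolding S_zariski_def by (simp add: topology_inverse'[OF istopology_S_zariski[OF assms]])
  have V: "S_V R S I \<subseteq> S_Spec R S" for I by (auto simp: S_V_iff)
  have "S_V R S (carrier R) = {}"
  proof -
    have "False" if P: "P \<in> S_V R S (carrier R)" for P
    proof -
      obtain s where "s \<in> S" "s \<otimes> \<one> \<in> P" using P by (auto simp: S_V_iff)
      moreover have "P \<inter> S = {}" using P by (auto simp: S_V_iff S_Spec_def S_prime_def)
      ultimately show False using assms(2) by (auto simp: mult_closed_subset_def)
    qed
    then show ?thesis by blast
  qed
  then have "openin (S_zariski R S) (S_Spec R S)" using o oneideal by auto
  then have t: "topspace (S_zariski R S) = S_Spec R S"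
    by (intro subset_antisym) (use o openin_topspace in blast, use openin_subset in blast)
  show ?thesis
    unfolding closedin_def t o using V by (auto simp: double_diff)
qed

end

theory Submission
  imports Defs "HOL-Analysis.Function_Topology"
begin

text \<open>
  An \<open>S\<close>-prime ideal \<open>P\<close> with witness \<open>t\<close> has a companion \<open>P' = {a. t a \<in> P}\<close>, which is an
  ordinary prime ideal disjoint from \<open>S\<close>, and \<open>P \<in> V\<^sub>S(f)\<close> just means \<open>f \<in> P'\<close>. Conversely every
  prime ideal disjoint from \<open>S\<close> is \<open>S\<close>-prime and is its own companion. So covers of \<open>V\<^sub>S(I)\<close> by sets
  \<open>V\<^sub>S(f)\<close> behave as they do for the prime ideals of the localization of \<open>R\<close> at \<open>S\<close>.

  By Alexander's subbase theorem (\<open>compactin_topology_generated_byI\<close>) it is enough to treat covers of \<open>V\<^sub>S(I)\<close> by sets \<open>V\<^sub>S(f)\<close> with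
  \<open>f\<close> ranging over some \<open>F\<close>. Let \<open>T\<close> be the set of all products of an element of \<open>S\<close> with
  finitely many elements of \<open>F\<close>. If \<open>I\<close> did not meet \<open>T\<close>, an ideal containing \<open>I\<close> and maximal among those
  disjoint from \<open>T\<close> would be prime (\<open>exists_primeideal_disjoint\<close>); it would then be a point of \<open>V\<^sub>S(I)\<close> lying in no
  \<open>V\<^sub>S(f)\<close>, as it contains neither an element of \<open>S\<close> nor one of \<open>F\<close>.
  Hence some product \<open>f\<^sub>1 \<cdots> f\<^sub>n s\<close> lies in \<open>I\<close>. For every \<open>P\<close> in \<open>V\<^sub>S(I)\<close> this product lies
  in the prime ideal \<open>P'\<close>, so some \<open>f\<^sub>i\<close> does (\<open>S_V_mult_hull_finite_cover\<close>), and \<open>V\<^sub>S(f\<^sub>1), \<dots>, V\<^sub>S(f\<^sub>n)\<close> cover \<open>V\<^sub>S(I)\<close>.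
\<close>

section \<open>Compact sets in a generated topology\<close>

text \<open>Alexander's subbase theorem speaks about unions of finite intersections relative to \<open>K\<close>, and
  shows that the space \<open>Y\<close> they form is compact. The inclusion of \<open>Y\<close> into the generated topology
  is continuous, because that need only be tested on \<open>\<B>\<close>; so its image \<open>K\<close> is compact.\<close>

lemma compactin_topology_generated_byI:
  assumes K: "K \<subseteq> \<Union>\<B>"
    and fin: "\<And>\<C>. \<lbrakk>\<C> \<subseteq> \<B>; K \<subseteq> \<Union>\<C>\<rbrakk> \<Longrightarrow> \<exists>\<C>'. finite \<C>' \<and> \<C>' \<subseteq> \<C> \<and> K \<subseteq> \<Union>\<C>'"
  shows "compactin (topology_generated_by \<B>) K"
proof -
  define Y where "Y = topology (arbitrary union_of (finite intersection_of (\<lambda>U. U \<in> \<B>) relative_to K))"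
  have topspace_Y: "topspace Y = K" by (simp add: Y_def)
  have "compact_space Y"
    using Alexander_subbase_alt[OF K fin Y_def[symmetric]] .
  moreover have "continuous_map Y (topology_generated_by \<B>) id"
  proof (rule continuous_on_generated_topo)
    fix U assume "U \<in> \<B>"
    then have "openin Y (K \<inter> U)"
      unfolding Y_def openin_subbase
      by (intro arbitrary_union_of_inc relative_to_inc finite_intersection_of_inc)
    moreover have "K \<inter> U = id -` U \<inter> topspace Y" unfolding topspace_Y by auto
    ultimately show "openin Y (id -` U \<inter> topspace Y)" by (simp only:)
  qed (use K topspace_Y in simp)
  ultimately show ?thesis
    using image_compactin[of Y "topspace Y"] topspace_Y by (fastforce simp: compact_space_def)
qed

section \<open>Prime ideals disjoint from a multiplicative set\<close>

text \<open>Krull's lemma. Let \<open>Q\<close> be maximal among the ideals that contain \<open>I\<close> and are disjoint from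
  \<open>T\<close>. If \<open>a\<close> and \<open>b\<close> lie outside \<open>Q\<close>, then \<open>Q + (a)\<close> and \<open>Q + (b)\<close> both meet \<open>T\<close>; the product of
  an element of each intersection is in \<open>T\<close>, hence not in \<open>Q\<close>, whereas it would be in \<open>Q\<close> if \<open>a b\<close>
  were.\<close>

lemma (in cring) exists_primeideal_disjoint:
  assumes I: "ideal I R" and T: "T \<subseteq> carrier R" "T \<noteq> {}"
    and mult: "\<And>x y. \<lbrakk>x \<in> T; y \<in> T\<rbrakk> \<Longrightarrow> x \<otimes> y \<in> T"
    and disj: "I \<inter> T = {}"
  obtains Q where "primeideal Q R" "I \<subseteq> Q" "Q \<inter> T = {}"
proof -
  define \<A> where "\<A> = {J. ideal J R \<and> I \<subseteq> J \<and> J \<inter> T = {}}"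
  have "\<exists>Q\<in>\<A>. \<forall>J\<in>\<A>. Q \<subseteq> J \<longrightarrow> J = Q"
  proof (rule subset_Zorn_nonempty)
    show "\<A> \<noteq> {}" using I disj by (auto simp: \<A>_def)
  next
    fix \<C> assume ne: "\<C> \<noteq> {}" and ch: "subset.chain \<A> \<C>"
    then have "subset.chain {J. ideal J R} \<C>"
      by (auto simp: \<A>_def pred_on.chain_def)
    from chain_Union_is_ideal[OF this] ne have "ideal (\<Union>\<C>) R" by simp
    moreover have members: "I \<subseteq> J" "J \<inter> T = {}" if "J \<in> \<C>" for J
      using ch that by (auto simp: \<A>_def pred_on.chain_def)
    moreover have "I \<subseteq> \<Union>\<C>" using ne members(1) by blast
    moreover have "\<Union>\<C> \<inter> T = {}" using members(2) by blast
    ultimately show "\<Union>\<C> \<in> \<A>" by (simp add: \<A>_def)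
  qed
  then obtain Q where Q: "ideal Q R" "I \<subseteq> Q" "Q \<inter> T = {}"
    and max: "\<And>J. \<lbrakk>ideal J R; I \<subseteq> J; J \<inter> T = {}; Q \<subseteq> J\<rbrakk> \<Longrightarrow> J = Q"
    by (auto simp: \<A>_def)
  interpret Q: ideal Q R by fact
  have meets: "\<exists>q\<in>Q. \<exists>r\<in>carrier R. q \<oplus> r \<otimes> a \<in> T" if a: "a \<in> carrier R" "a \<notin> Q" for a
  proof -
    have sum_ideal: "ideal (Q <+> PIdl a) R"
      using Q(1) cgenideal_ideal[OF a(1)] by (rule add_ideals)
    have sub: "Q \<union> PIdl a \<subseteq> Q <+> PIdl a"
      unfolding union_genideal[OF Q(1) cgenideal_ideal[OF a(1)], symmetric]
      by (rule genideal_self) (use Q.a_subset cgenideal_ideal[OF a(1)] in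
          \<open>auto dest: ideal.Icarr\<close>)
    have "a \<in> Q <+> PIdl a" using sub cgenideal_self[OF a(1)] by blast
    then have "(Q <+> PIdl a) \<inter> T \<noteq> {}"
      using max[OF sum_ideal] sub Q(2) a(2) by blast
    then show ?thesis by (auto simp: set_add_defs cgenideal_def)
  qed
  have "primeideal Q R"
  proof (rule primeidealI[OF Q(1) cring_axioms])
    show "carrier R \<noteq> Q" using T Q(3) by blast
  next
    fix a b assume a: "a \<in> carrier R" and b: "b \<in> carrier R" and ab: "a \<otimes> b \<in> Q"
    show "a \<in> Q \<or> b \<in> Q"
    proof (rule ccontr)
      assume "\<not> (a \<in> Q \<or> b \<in> Q)"
      then have nQ: "a \<notin> Q" "b \<notin> Q" by blast+
      obtain q r where q: "q \<in> Q" and r: "r \<in> carrier R" and t: "q \<oplus> r \<otimes> a \<in> T"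
        using meets[OF a nQ(1)] by blast
      obtain q' r' where q': "q' \<in> Q" and r': "r' \<in> carrier R" and t': "q' \<oplus> r' \<otimes> b \<in> T"
        using meets[OF b nQ(2)] by blast
      have c: "q \<in> carrier R" "q' \<in> carrier R" using q q' by (simp_all add: Q.Icarr)
      have "(q \<oplus> r \<otimes> a) \<otimes> (q' \<oplus> r' \<otimes> b)
          = q \<otimes> (q' \<oplus> r' \<otimes> b) \<oplus> ((r \<otimes> a) \<otimes> q' \<oplus> (r \<otimes> r') \<otimes> (a \<otimes> b))"
        using a b r r' c by algebra
      also have "\<dots> \<in> Q"
        using a b r r' c q q' ab by (simp add: Q.I_r_closed Q.I_l_closed)
      finally show False using mult[OF t t'] Q(3) by blast
    qed
  qed
  with Q that show thesis by blast
qed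

section \<open>The sets \<open>V\<^sub>S(f)\<close> for products \<open>f\<close>\<close>

text \<open>Every element carries a factor from \<open>S\<close>. For multiplicatively closed \<open>S\<close> this is the multiplicative set
  generated by \<open>S \<union> F\<close>, as \<open>\<one> \<in> S\<close>. The inductive form lets
  statements about products be proved one factor from \<open>F\<close> at a time.\<close>

inductive_set mult_hull :: "('a, 'b) ring_scheme \<Rightarrow> 'a set \<Rightarrow> 'a set \<Rightarrow> 'a set"
  for R :: "('a, 'b) ring_scheme" and S F where
  base: "s \<in> S \<Longrightarrow> s \<in> mult_hull R S F"
| step: "\<lbrakk>f \<in> F; x \<in> mult_hull R S F\<rbrakk> \<Longrightarrow> f \<otimes>\<^bsub>R\<^esub> x \<in> mult_hull R S F"

lemma mult_hull_closed:
  fixes R :: "('a, 'b) ring_scheme" (structure)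
  assumes "cring R" "mult_closed_subset R S" "F \<subseteq> carrier R"
  shows "mult_hull R S F \<subseteq> carrier R"
    and "\<lbrakk>x \<in> mult_hull R S F; y \<in> mult_hull R S F\<rbrakk> \<Longrightarrow> x \<otimes> y \<in> mult_hull R S F"
proof -
  interpret cring R by fact
  have S: "S \<subseteq> carrier R" "\<And>s s'. \<lbrakk>s \<in> S; s' \<in> S\<rbrakk> \<Longrightarrow> s \<otimes> s' \<in> S"
    using assms(2) by (auto simp: mult_closed_subset_def)
  have carr: "x \<in> carrier R" if "x \<in> mult_hull R S F" for x
    using that by induction (use S assms(3) in auto)
  then show "mult_hull R S F \<subseteq> carrier R" by blast
  have S_mult: "s \<otimes> y \<in> mult_hull R S F" if "y \<in> mult_hull R S F" "s \<in> S" for s y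
    using that
  proof induction
    case (base s')
    then show ?case using S(2) by (blast intro: mult_hull.base)
  next
    case (step f y)
    moreover have "f \<in> carrier R" "s \<in> carrier R" "y \<in> carrier R"
      using step S(1) assms(3) carr by auto
    then have "s \<otimes> (f \<otimes> y) = f \<otimes> (s \<otimes> y)" by (simp add: m_lcomm)
    ultimately show ?case by (simp add: mult_hull.step)
  qed
  show "x \<otimes> y \<in> mult_hull R S F" if "x \<in> mult_hull R S F" "y \<in> mult_hull R S F"
    using that(1)
  proof induction
    case (base s)
    then show ?case using S_mult that(2) by blast
  next
    case (step f x)
    moreover have "(f \<otimes> x) \<otimes> y = f \<otimes> (x \<otimes> y)"
      using step carr that(2) assms(3) by (intro m_assoc) auto
    ultimately show ?case by (simp add: mult_hull.step)
  qed
qed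

lemma primeideal_in_S_Spec:
  assumes "mult_closed_subset R S" "primeideal Q R" "Q \<inter> S = {}"
  shows "Q \<in> S_Spec R S"
proof -
  interpret primeideal Q R by fact
  have "\<one>\<^bsub>R\<^esub> \<in> S" using assms(1) by (simp add: mult_closed_subset_def)
  moreover have "\<one>\<^bsub>R\<^esub> \<otimes>\<^bsub>R\<^esub> a \<in> Q \<or> \<one>\<^bsub>R\<^esub> \<otimes>\<^bsub>R\<^esub> b \<in> Q"
    if "a \<in> carrier R" "b \<in> carrier R" "a \<otimes>\<^bsub>R\<^esub> b \<in> Q" for a b
    using I_prime[OF that] that by simp
  ultimately show ?thesis
    using is_ideal assms(3) unfolding S_Spec_def S_prime_def by blast
qed

text \<open>A prime ideal disjoint from \<open>S\<close> is its own companion, because a multiplier from \<open>S\<close> can be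
  cancelled.\<close>

lemma S_V_primeideal_iff:
  assumes "mult_closed_subset R S" "primeideal Q R" "Q \<inter> S = {}" "E \<subseteq> carrier R"
  shows "Q \<in> S_V R S E \<longleftrightarrow> E \<subseteq> Q"
proof -
  interpret primeideal Q R by fact
  have S: "S \<subseteq> carrier R" "\<one>\<^bsub>R\<^esub> \<in> S" using assms(1) by (auto simp: mult_closed_subset_def)
  have "E \<subseteq> Q" if "s \<in> S" "\<forall>e\<in>E. s \<otimes>\<^bsub>R\<^esub> e \<in> Q" for s
    using that I_prime[of s] S(1) assms(3,4) by blast
  moreover have "\<forall>e\<in>E. \<one>\<^bsub>R\<^esub> \<otimes>\<^bsub>R\<^esub> e \<in> Q" if "E \<subseteq> Q"
    using that by auto
  ultimately show ?thesis
    using S(2) primeideal_in_S_Spec[OF assms(1-3)] unfolding S_V_iff by blast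
qed

text \<open>This is the primality of the companion \<open>P'\<close>. If \<open>s (a b) \<in> P\<close> and \<open>t\<close> witnesses that \<open>P\<close> is
  \<open>S\<close>-prime, then \<open>t\<close> applied to \<open>(s a) b\<close> gives \<open>(t s) a \<in> P\<close> or \<open>t b \<in> P\<close>, and both \<open>t s\<close> and
  \<open>t\<close> belong to \<open>S\<close>.\<close>

lemma S_V_mult_subset:
  fixes R :: "('a, 'b) ring_scheme" (structure)
  assumes "cring R" "mult_closed_subset R S" "a \<in> carrier R" "b \<in> carrier R"
  shows "S_V R S {a \<otimes> b} \<subseteq> S_V R S {a} \<union> S_V R S {b}"
proof
  interpret cring R by fact
  fix P assume P: "P \<in> S_V R S {a \<otimes> b}"
  then have PS: "P \<in> S_Spec R S" by (simp add: S_V_iff)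
  obtain t where t: "t \<in> S"
      "\<And>a b. \<lbrakk>a \<in> carrier R; b \<in> carrier R; a \<otimes> b \<in> P\<rbrakk> \<Longrightarrow> t \<otimes> a \<in> P \<or> t \<otimes> b \<in> P"
    by (rule S_V_witness[OF assms(1,2) PS]) blast
  obtain s where s: "s \<in> S" "s \<otimes> (a \<otimes> b) \<in> P" using P by (auto simp: S_V_iff)
  have S: "s \<in> carrier R" "t \<in> carrier R" "t \<otimes> s \<in> S"
    using s(1) t(1) assms(2) by (auto simp: mult_closed_subset_def)
  have "(s \<otimes> a) \<otimes> b \<in> P" using s(2) S assms(3,4) by (simp add: m_assoc)
  then have "t \<otimes> (s \<otimes> a) \<in> P \<or> t \<otimes> b \<in> P" using t(2) S assms(3,4) by simp
  then have "(t \<otimes> s) \<otimes> a \<in> P \<or> t \<otimes> b \<in> P" using S assms(3) by (simp add: m_assoc)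
  then show "P \<in> S_V R S {a} \<union> S_V R S {b}"
    using PS S(3) t(1) unfolding Un_iff S_V_iff by blast
qed

lemma S_V_element_of_S_empty:
  assumes "mult_closed_subset R S" "s \<in> S"
  shows "S_V R S {s} = {}"
proof -
  have False if P: "P \<in> S_V R S {s}" for P
  proof -
    obtain t where "t \<in> S" "t \<otimes>\<^bsub>R\<^esub> s \<in> P" using P by (auto simp: S_V_iff)
    moreover have "P \<inter> S = {}" using P by (simp add: S_V_iff S_Spec_def S_prime_def)
    ultimately show False using assms unfolding mult_closed_subset_def by blast
  qed
  then show ?thesis by blast
qed

text \<open>The finite subcover comes from the factors of a single element: the factor from \<open>S\<close>
  contributes the empty set, and each of the finitely many factors \<open>g \<in> F\<close> contributes
  \<open>V\<^sub>S(g)\<close>.\<close>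

lemma S_V_mult_hull_finite_cover:
  fixes R :: "('a, 'b) ring_scheme" (structure)
  assumes "cring R" "mult_closed_subset R S" "F \<subseteq> carrier R" "x \<in> mult_hull R S F"
  shows "\<exists>G. finite G \<and> G \<subseteq> F \<and> S_V R S {x} \<subseteq> (\<Union>g\<in>G. S_V R S {g})"
  using assms(4)
proof induction
  case (base s)
  then show ?case using S_V_element_of_S_empty[OF assms(2)] by auto
next
  case (step f x)
  then obtain G where G: "finite G" "G \<subseteq> F" "S_V R S {x} \<subseteq> (\<Union>g\<in>G. S_V R S {g})" by blast
  have "S_V R S {f \<otimes> x} \<subseteq> S_V R S {f} \<union> S_V R S {x}"
    using step mult_hull_closed(1)[OF assms(1-3)] assms(3)
    by (intro S_V_mult_subset[OF assms(1,2)]) auto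
  with G step(1) show ?case by (intro exI[of _ "insert f G"]) auto
qed

section \<open>Compactness of \<open>V\<^sub>S(I)\<close>\<close>

lemma S_V_finite_subcover:
  fixes R :: "('a, 'b) ring_scheme" (structure)
  assumes "cring R" "mult_closed_subset R S" "ideal I R" "F \<subseteq> carrier R"
    and cover: "S_V R S I \<subseteq> (\<Union>f\<in>F. S_V R S {f})"
  shows "\<exists>G. finite G \<and> G \<subseteq> F \<and> S_V R S I \<subseteq> (\<Union>g\<in>G. S_V R S {g})"
proof -
  interpret cring R by fact
  interpret I: ideal I R by fact
  let ?T = "mult_hull R S F"
  note hull = mult_hull_closed[OF assms(1,2,4)]
  have one: "\<one> \<in> S" using assms(2) by (simp add: mult_closed_subset_def)
  \<comment> \<open>Otherwise Krull's lemma produces a point of \<open>V\<^sub>S(I)\<close> that the cover misses.\<close>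
  have "I \<inter> ?T \<noteq> {}"
  proof
    assume "I \<inter> ?T = {}"
    then obtain Q where Q: "primeideal Q R" "I \<subseteq> Q" "Q \<inter> ?T = {}"
      using exists_primeideal_disjoint[OF assms(3) hull(1) _ hull(2)] mult_hull.base[OF one]
      by blast
    have QS: "Q \<inter> S = {}" using Q(3) by (auto intro: mult_hull.base)
    note V_iff = S_V_primeideal_iff[OF assms(2) Q(1) QS]
    have "Q \<in> S_V R S I" using Q(2) V_iff[OF I.a_subset] by simp
    then obtain f where f: "f \<in> F" "Q \<in> S_V R S {f}" using cover by blast
    then have "f \<in> Q" "f \<in> carrier R" using V_iff[of "{f}"] assms(4) by auto
    \<comment> \<open>The factor \<open>\<one>\<close> supplies the element of \<open>S\<close> that members of the hull carry.\<close>
    moreover have "f \<otimes> \<one> \<in> ?T" using f(1) one by (intro mult_hull.intros)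
    ultimately show False using Q(3) by auto
  qed
  then obtain x where x: "x \<in> I" "x \<in> ?T" by blast
  have "S_V R S I \<subseteq> S_V R S {x}"
    using x(1) unfolding subset_iff S_V_iff by blast
  with S_V_mult_hull_finite_cover[OF assms(1,2,4) x(2)] show ?thesis by blast
qed

lemma compactin_S_flat_S_V:
  assumes "cring R" "mult_closed_subset R S" "ideal I R"
  shows "compactin (S_flat R S) (S_V R S I)"
  unfolding S_flat_def
proof (rule compactin_topology_generated_byI)
  have "S_V R S I \<subseteq> topspace (S_flat R S)"
    unfolding topspace_S_flat[OF assms(1,2)] by (auto simp: S_V_iff)
  then show "S_V R S I \<subseteq> \<Union>{S_V R S {f} |f. f \<in> carrier R}"
    by (simp add: S_flat_def)
next
  fix \<C> assume sub: "\<C> \<subseteq> {S_V R S {f} |f. f \<in> carrier R}" and cover: "S_V R S I \<subseteq> \<Union>\<C>"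
  define F where "F = {f \<in> carrier R. S_V R S {f} \<in> \<C>}"
  have "\<C> \<subseteq> (\<lambda>f. S_V R S {f}) ` F"
  proof
    fix C assume C: "C \<in> \<C>"
    with sub obtain f where "f \<in> carrier R" "C = S_V R S {f}" by blast
    with C show "C \<in> (\<lambda>f. S_V R S {f}) ` F" unfolding F_def by blast
  qed
  with cover have "S_V R S I \<subseteq> (\<Union>f\<in>F. S_V R S {f})" by blast
  moreover have "F \<subseteq> carrier R" by (auto simp: F_def)
  ultimately obtain G where "finite G" "G \<subseteq> F" "S_V R S I \<subseteq> (\<Union>g\<in>G. S_V R S {g})"
    using S_V_finite_subcover[OF assms, of F] by blast
  then show "\<exists>\<C>'. finite \<C>' \<and> \<C>' \<subseteq> \<C> \<and> S_V R S I \<subseteq> \<Union>\<C>'"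
    by (intro exI[of _ "(\<lambda>g. S_V R S {g}) ` G"]) (auto simp: F_def)
qed

theorem theorem4p2:
  fixes R :: "('a, 'b) ring_scheme"
  assumes "cring R"
    and "\<one>\<^bsub>R\<^esub> \<noteq> \<zero>\<^bsub>R\<^esub>"
    and "mult_closed_subset R S"
    and "ideal I R"
  shows "compactin (S_flat R S) (S_V R S I) \<and>
         (\<forall>C. closedin (S_zariski R S) C \<longrightarrow> compactin (S_flat R S) C)"
proof (intro conjI allI impI)
  show "compactin (S_flat R S) (S_V R S I)"
    using assms(1,3,4) by (rule compactin_S_flat_S_V)
next
  fix C assume "closedin (S_zariski R S) C"
  then obtain J where "ideal J R" "C = S_V R S J"
    unfolding closedin_S_zariski_iff[OF assms(1,3)] by (elim exE conjE)
  then show "compactin (S_flat R S) C"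
    using compactin_S_flat_S_V[OF assms(1,3)] by simp
qed

end
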